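(* Consider a dynamic generalized factor analysis (DGFA) model and its truncations $$\mathbf x(t+1)=A\mathbf x(t)+\mathbf v(t),\qquad \mathbf y_N(t)=C_N\mathbf x(t)+\mathbf w_N(t),\qquad N=1,2,\dots$$ satisfying all the standing assumptions (A)–(F) listed in the context, and let $\hat{\mathbf x}_N(t\mid t-1)$ be the steady-state one-step-ahead Kalman predictor of $\mathbf x(t)$. Then the steady-state prediction error of the state, $\mathbf x(t)-\hat{\mathbf x}_N(t\mid t-1)$, does not converge to zero in mean square as $N\to\infty$. In particular, the one-step-ahead predictor $\hat{\boldsymbol\chi}_N(t\mid t-1)=C_N\hat{\mathbf x}_N(t\mid t-1)$ of the common component vector $\boldsymbol\chi_N(t):=C_N\mathbf x(t)$ converges, as $N\to\infty$, neither to $C\mathbf x(t)$ nor to the measured signal $\mathbf y(t)$ in mean square; that is, neither $\mathbb E\|C_N\mathbf x(t)-C_N\hat{\mathbf x}_N(t\mid t-1)\|^2$ nor $\mathbb E\|\mathbf y_N(t)-C_N\hat{\mathbf x}_N(t\mid t-1)\|^2$ converges to $0$.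
   Context: All random variables are real, zero-mean, with finite variance; $^\top$ is transpose; $\|\cdot\|$ is the Euclidean norm on vectors and the operator norm on matrices. Model. Time is $t\in\mathbb Z$. The infinite-dimensional model is $\mathbf x(t+1)=A\mathbf x(t)+\mathbf v(t)$, $\mathbf y(t)=C\mathbf x(t)+\mathbf w(t)$, where $\mathbf x(t)$ and $\mathbf v(t)$ are $n$-dimensional ($n\ge 1$ fixed), $\mathbf y(t),\mathbf w(t)$ are random vectors with countably many components, and $C$ is an $\infty\times n$ real matrix. $\mathbf y_N(t)$, $\mathbf w_N(t)$ denote the vectors of the first $N$ components of $\mathbf y(t)$, $\mathbf w(t)$, and $C_N\in\mathbb R^{N\times n}$ consists of the first $N$ rows of $C$. Standing assumptions: (A) $A\in\mathbb R^{n\times n}$ is asymptotically stable (all eigenvalues of modulus $<1$), $\mathbf v$ is a white noise with covariance $Q$, and $\mathbf x$ is the stationary process solving the state equation. (B) $\mathbf w$ is a stationary white noise (in $t$), uncorrelated with $\mathbf v$ at all times; its components need not be mutually uncorrelated. (C) The columns of $C$ are strongly linearly independent, i.e. $\lim_{N\to\infty}\lambda_{\min}[C_N^\top C_N]=+\infty$, with $\lambda_{\min}$ the smallest eigenvalue. (D) $\mathbf w(0)$ (hence $\mathbf w(t)$ for every $t$) is an idiosyncratic sequence with respect to the cross-sectional index; equivalently, with $R_N:=\mathbb E[\mathbf w_N(t)\mathbf w_N(t)^\top]$, $\sup_N\|R_N\|<\infty$. (E) The model is wide-sense stationary and minimal, so that $(A,Q)$ is reachable. (F) $R_N>0$ (positive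 definite) for all $N$. Idiosyncratic. A zero-mean random sequence $\mathbf z=(\mathbf z(k))_{k\ge1}$ with covariance $\Sigma$ is idiosyncratic if $\lim_{m\to\infty}a_m^\top\mathbf z=0$ in mean square for every sequence $(a_m)$ of elements of $\ell^2$ with $a_m^\top\Sigma a_m<\infty$ and $\|a_m\|_{\ell^2}\to0$; equivalently, the covariances of the truncations to the first $N$ components are bounded in operator norm uniformly in $N$. Kalman predictor. $\hat{\mathbf x}_N(t\mid t-1)$ is the best linear (minimum-variance) estimate of $\mathbf x(t)$ given the infinite past $\{\mathbf y_N(s):s\le t-1\}$. The covariance $P_N$ of $\mathbf x(t)-\hat{\mathbf x}_N(t\mid t-1)$ is the stabilizing solution of the algebraic Riccati equation $$P_N=A\big[P_N-P_NC_N^\top(C_NP_NC_N^\top+R_N)^{-1}C_NP_N\big]A^\top+Q.$$ *)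

theory Defs
  imports "HOL-Probability.Probability" "Jordan_Normal_Form.Spectral_Radius"
begin

text \<open>
  Vectors and matrices are those of \<open>Jordan_Normal_Form\<close>, since the dimension \<open>N\<close> varies.
  A random family \<open>X i\<close>, indexed from \<open>0\<close>, stands both for an infinite random sequence and,
  through its truncations, for random vectors: an \<open>n\<close>-dimensional random vector is a family of
  which only the components \<open>X i\<close> with \<open>i < n\<close> are used. Similarly an \<open>\<infinity> \<times> n\<close> matrix \<open>C\<close> has
  entries \<open>C k i\<close> with \<open>i < n\<close>.
\<close>

definition trunc_vec :: "nat \<Rightarrow> (nat \<Rightarrow> 'a \<Rightarrow> real) \<Rightarrow> 'a \<Rightarrow> real vec" where
  "trunc_vec N X \<omega> = vec N (\<lambda>i. X i \<omega>)"

definition trunc_mat :: "nat \<Rightarrow> nat \<Rightarrow> (nat \<Rightarrow> nat \<Rightarrow> real) \<Rightarrow> real mat" where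
  "trunc_mat N n C = mat N n (\<lambda>(k, i). C k i)"

definition vec_sq_norm :: "real vec \<Rightarrow> real" where
  "vec_sq_norm u = scalar_prod u u"

subsection \<open>Linear systems and matrices\<close>

definition asymptotically_stable :: "real mat \<Rightarrow> bool" where
  "asymptotically_stable A \<longleftrightarrow>
    (\<forall>\<mu>. eigenvalue (map_mat complex_of_real A) \<mu> \<longrightarrow> cmod \<mu> < 1)"

text \<open>Only used for symmetric matrices of positive dimension, whose real spectrum is finite,
  nonempty, and contains all eigenvalues.\<close>
definition lambda_min :: "real mat \<Rightarrow> real" where
  "lambda_min S = Min (spectrum S)"

definition strongly_linearly_independent :: "nat \<Rightarrow> (nat \<Rightarrow> nat \<Rightarrow> real) \<Rightarrow> bool" where
  "strongly_linearly_independent n C \<longleftrightarrow>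
    filterlim (\<lambda>N. lambda_min (transpose_mat (trunc_mat N n C) * trunc_mat N n C))
      at_top sequentially"

definition positive_definite :: "real mat \<Rightarrow> bool" where
  "positive_definite S \<longleftrightarrow> dim_row S = dim_col S \<and> transpose_mat S = S \<and>
    (\<forall>u \<in> carrier_vec (dim_row S). u \<noteq> 0\<^sub>v (dim_row S) \<longrightarrow> 0 < scalar_prod u (S *\<^sub>v u))"

text \<open>The state at a given time of \<open>\<xi>(k+1) = A \<xi>(k) + B u(k)\<close>, started at \<open>\<xi>(0) = 0\<close>.\<close>
primrec driven_state :: "real mat \<Rightarrow> real mat \<Rightarrow> (nat \<Rightarrow> real vec) \<Rightarrow> nat \<Rightarrow> real vec" where
  "driven_state A B u 0 = 0\<^sub>v (dim_row A)"
| "driven_state A B u (Suc k) = A *\<^sub>v driven_state A B u k + B *\<^sub>v u k"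

definition reachable :: "real mat \<Rightarrow> real mat \<Rightarrow> bool" where
  "reachable A B \<longleftrightarrow>
    (\<forall>\<xi> \<in> carrier_vec (dim_row A). \<exists>T u. (\<forall>k. u k \<in> carrier_vec (dim_col B)) \<and>
      driven_state A B u T = \<xi>)"

definition observable :: "real mat \<Rightarrow> (nat \<Rightarrow> nat \<Rightarrow> real) \<Rightarrow> bool" where
  "observable A C \<longleftrightarrow>
    (\<forall>\<xi> \<in> carrier_vec (dim_row A).
      (\<forall>k N. trunc_mat N (dim_row A) C *\<^sub>v ((A ^\<^sub>m k) *\<^sub>v \<xi>) = 0\<^sub>v N) \<longrightarrow> \<xi> = 0\<^sub>v (dim_row A))"

subsection \<open>Second-order random variables and processes\<close>

definition zero_mean_L2 :: "'a measure \<Rightarrow> ('a \<Rightarrow> real) \<Rightarrow> bool" where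
  "zero_mean_L2 M X \<longleftrightarrow> X \<in> borel_measurable M \<and> integrable M (\<lambda>\<omega>. (X \<omega>)\<^sup>2) \<and>
    (LINT \<omega>|M. X \<omega>) = 0"

definition cov :: "'a measure \<Rightarrow> ('a \<Rightarrow> real) \<Rightarrow> ('a \<Rightarrow> real) \<Rightarrow> real" where
  "cov M X Y = (LINT \<omega>|M. X \<omega> * Y \<omega>)"  \<comment> \<open>for zero-mean variables\<close>

definition wide_sense_stationary ::
  "'a measure \<Rightarrow> 'i set \<Rightarrow> (int \<Rightarrow> 'i \<Rightarrow> 'a \<Rightarrow> real) \<Rightarrow> bool" where
  "wide_sense_stationary M I Z \<longleftrightarrow>
    (\<forall>t. \<forall>i\<in>I. zero_mean_L2 M (Z t i)) \<and>
    (\<forall>t s h. \<forall>i\<in>I. \<forall>j\<in>I. cov M (Z (t + h) i) (Z (s + h) j) = cov M (Z t i) (Z s j))"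

text \<open>White in time only: the covariance \<open>\<Sigma>\<close> across components is arbitrary.\<close>
definition white_noise ::
  "'a measure \<Rightarrow> 'i set \<Rightarrow> (int \<Rightarrow> 'i \<Rightarrow> 'a \<Rightarrow> real) \<Rightarrow> ('i \<Rightarrow> 'i \<Rightarrow> real) \<Rightarrow> bool" where
  "white_noise M I Z \<Sigma> \<longleftrightarrow>
    (\<forall>t. \<forall>i\<in>I. zero_mean_L2 M (Z t i)) \<and>
    (\<forall>t s. \<forall>i\<in>I. \<forall>j\<in>I. cov M (Z t i) (Z s j) = (if t = s then \<Sigma> i j else 0))"

definition ms_tendsto :: "'a measure \<Rightarrow> (nat \<Rightarrow> 'a \<Rightarrow> real) \<Rightarrow> ('a \<Rightarrow> real) \<Rightarrow> bool" where
  "ms_tendsto M X Y \<longleftrightarrow>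
    Y \<in> borel_measurable M \<and> integrable M (\<lambda>\<omega>. (Y \<omega>)\<^sup>2) \<and>
    (\<lambda>N. LINT \<omega>|M. (X N \<omega> - Y \<omega>)\<^sup>2) \<longlonglongrightarrow> 0"

text \<open>Here \<open>S m\<close> is the random variable \<open>a\<^sub>m\<^sup>T z\<close>, i.e. the mean-square sum of the series
  \<open>\<Sum>k. a\<^sub>m(k) z(k)\<close>; the third condition is \<open>a\<^sub>m\<^sup>T \<Sigma> a\<^sub>m < \<infinity>\<close>.\<close>
definition idiosyncratic :: "'a measure \<Rightarrow> (nat \<Rightarrow> 'a \<Rightarrow> real) \<Rightarrow> bool" where
  "idiosyncratic M z \<longleftrightarrow>
    (\<forall>a S. (\<forall>m. summable (\<lambda>k. (a m k)\<^sup>2)) \<and>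
      (\<lambda>m. sqrt (\<Sum>k. (a m k)\<^sup>2)) \<longlonglongrightarrow> 0 \<and>
      (\<forall>m. convergent (\<lambda>N. \<Sum>i<N. \<Sum>j<N. a m i * cov M (z i) (z j) * a m j)) \<and>
      (\<forall>m. ms_tendsto M (\<lambda>N \<omega>. \<Sum>k<N. a m k * z k \<omega>) (S m)) \<longrightarrow>
      ms_tendsto M S (\<lambda>\<omega>. 0))"

subsection \<open>Linear estimation\<close>

definition closed_linear_span :: "'a measure \<Rightarrow> ('a \<Rightarrow> real) set \<Rightarrow> ('a \<Rightarrow> real) set" where
  "closed_linear_span M H =
    {Z. Z \<in> borel_measurable M \<and> integrable M (\<lambda>\<omega>. (Z \<omega>)\<^sup>2) \<and>
      (\<forall>\<epsilon>>0. \<exists>F c. finite F \<and> F \<subseteq> H \<and> (LINT \<omega>|M. (Z \<omega> - (\<Sum>f\<in>F. c f * f \<omega>))\<^sup>2) < \<epsilon>)}"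

definition best_linear_estimate ::
  "'a measure \<Rightarrow> ('a \<Rightarrow> real) set \<Rightarrow> ('a \<Rightarrow> real) \<Rightarrow> ('a \<Rightarrow> real) \<Rightarrow> bool" where
  "best_linear_estimate M H X Z \<longleftrightarrow> Z \<in> closed_linear_span M H \<and>
    (\<forall>Z' \<in> closed_linear_span M H. (LINT \<omega>|M. (X \<omega> - Z \<omega>)\<^sup>2) \<le> (LINT \<omega>|M. (X \<omega> - Z' \<omega>)\<^sup>2))"

definition past :: "(int \<Rightarrow> nat \<Rightarrow> 'a \<Rightarrow> real) \<Rightarrow> nat \<Rightarrow> int \<Rightarrow> ('a \<Rightarrow> real) set" where
  "past y N t = {y s k | s k. s \<le> t \<and> k < N}"

text \<open>\<open>xh\<close> is (a version of) the steady-state one-step-ahead predictor of \<open>x(t)\<close>: every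
  component is estimated from the infinite past, up to \<open>t - 1\<close>, of the first \<open>N\<close> outputs.\<close>
definition kalman_predictor ::
  "'a measure \<Rightarrow> nat \<Rightarrow> (int \<Rightarrow> nat \<Rightarrow> 'a \<Rightarrow> real) \<Rightarrow> (int \<Rightarrow> nat \<Rightarrow> 'a \<Rightarrow> real) \<Rightarrow>
    nat \<Rightarrow> int \<Rightarrow> (nat \<Rightarrow> 'a \<Rightarrow> real) \<Rightarrow> bool" where
  "kalman_predictor M n x y N t xh \<longleftrightarrow>
    (\<forall>i<n. best_linear_estimate M (past y N (t - 1)) (x t i) (xh i))"

end

theory Submission
  imports Defs
begin

text \<open>
  The innovation \<open>v(t - 1)\<close> is orthogonal to the past outputs \<open>y(s)\<close>, \<open>s < t\<close>, hence to the predictor,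
  for every \<open>N\<close>. So for each row \<open>c\<close> the error \<open>c (x(t) - xhat(t))\<close> has covariance \<open>c Q e\<^sub>i\<close> with
  \<open>v\<^sub>i(t - 1)\<close>, and by Cauchy--Schwarz its variance is at least \<open>(c Q e\<^sub>i)\<^sup>2 / Q\<^sub>i\<^sub>i\<close>, independently
  of \<open>N\<close>. Reachability provides an \<open>i\<close> with \<open>Q\<^sub>i\<^sub>i > 0\<close>, which settles the state error (\<open>c = e\<^sub>i\<close>). If one
  of the output errors vanished in the limit, then \<open>C Q e\<^sub>i = 0\<close> with \<open>Q e\<^sub>i \<noteq> 0\<close>, which
  strong linear independence excludes.
\<close>

section \<open>Square-integrable random variables\<close>

text \<open>Unlike \<open>zero_mean_L2\<close>, no condition on the mean: elements of
  \<open>closed_linear_span\<close> are only known to be square integrable.\<close>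

definition square_int :: "'a measure \<Rightarrow> ('a \<Rightarrow> real) \<Rightarrow> bool" where
  "square_int M X \<longleftrightarrow> X \<in> borel_measurable M \<and> integrable M (\<lambda>\<omega>. (X \<omega>)\<^sup>2)"

lemma square_int_mult:
  assumes "square_int M X" "square_int M Y"
  shows "integrable M (\<lambda>\<omega>. X \<omega> * Y \<omega>)"
proof (rule Bochner_Integration.integrable_bound)
  show "integrable M (\<lambda>\<omega>. (X \<omega>)\<^sup>2 + (Y \<omega>)\<^sup>2)"
    using assms by (auto simp: square_int_def)
  show "(\<lambda>\<omega>. X \<omega> * Y \<omega>) \<in> borel_measurable M"
    using assms by (auto simp: square_int_def)
  have "\<bar>a * b\<bar> \<le> a\<^sup>2 + b\<^sup>2" for a b :: real
  proof -
    have "2 * \<bar>a * b\<bar> \<le> a\<^sup>2 + b\<^sup>2"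
      using sum_squares_bound[of "\<bar>a\<bar>" "\<bar>b\<bar>"] by (simp add: abs_mult mult.assoc)
    then show ?thesis using abs_ge_zero[of "a * b"] by linarith
  qed
  then show "AE \<omega> in M. norm (X \<omega> * Y \<omega>) \<le> norm ((X \<omega>)\<^sup>2 + (Y \<omega>)\<^sup>2)"
    by (intro AE_I2) simp
qed

lemma square_int_add:
  assumes "square_int M X" "square_int M Y"
  shows "square_int M (\<lambda>\<omega>. X \<omega> + Y \<omega>)"
  using assms square_int_mult[OF assms]
  by (auto simp: square_int_def power2_sum mult.assoc intro!: Bochner_Integration.integrable_add)

lemma square_int_cmult:
  assumes "square_int M X"
  shows "square_int M (\<lambda>\<omega>. c * X \<omega>)"
  using assms by (auto simp: square_int_def power_mult_distrib)

lemma square_int_diff: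
  assumes "square_int M X" "square_int M Y"
  shows "square_int M (\<lambda>\<omega>. X \<omega> - Y \<omega>)"
  using square_int_add[OF assms(1) square_int_cmult[OF assms(2), of "-1"]] by simp

lemma square_int_lincomb:
  assumes "\<And>j. j \<in> J \<Longrightarrow> square_int M (X j)"
  shows "square_int M (\<lambda>\<omega>. \<Sum>j\<in>J. c j * X j \<omega>)"
proof (cases "finite J")
  case True
  then show ?thesis
    using assms
  proof (induction J rule: finite_induct)
    case empty
    then show ?case by (simp add: square_int_def)
  next
    case (insert j J)
    then show ?case by (simp add: square_int_add square_int_cmult)
  qed
qed (simp add: square_int_def)

lemma zero_mean_L2_square_int: "zero_mean_L2 M X \<Longrightarrow> square_int M X"
  by (simp add: zero_mean_L2_def square_int_def)

section \<open>Covariance as a positive semidefinite bilinear form\<close>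

lemma cov_self: "cov M X X = (LINT \<omega>|M. (X \<omega>)\<^sup>2)"
  by (simp add: cov_def power2_eq_square)

lemma cov_self_nonneg: "0 \<le> cov M X X"
  by (simp add: cov_self)

lemma cov_add_right:
  assumes "square_int M X" "square_int M Y" "square_int M Z"
  shows "cov M X (\<lambda>\<omega>. Y \<omega> + Z \<omega>) = cov M X Y + cov M X Z"
  using assms by (simp add: cov_def distrib_left square_int_mult)

lemma cov_diff_right:
  assumes "square_int M X" "square_int M Y" "square_int M Z"
  shows "cov M X (\<lambda>\<omega>. Y \<omega> - Z \<omega>) = cov M X Y - cov M X Z"
  using assms by (simp add: cov_def right_diff_distrib square_int_mult)

lemma cov_lincomb_right:
  assumes "square_int M X" "\<And>j. j \<in> J \<Longrightarrow> square_int M (Y j)"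
  shows "cov M X (\<lambda>\<omega>. \<Sum>j\<in>J. c j * Y j \<omega>) = (\<Sum>j\<in>J. c j * cov M X (Y j))"
proof -
  have "cov M X (\<lambda>\<omega>. \<Sum>j\<in>J. c j * Y j \<omega>) = (LINT \<omega>|M. (\<Sum>j\<in>J. c j * (X \<omega> * Y j \<omega>)))"
    by (simp add: cov_def sum_distrib_left mult.left_commute)
  also have "\<dots> = (\<Sum>j\<in>J. LINT \<omega>|M. c j * (X \<omega> * Y j \<omega>))"
    using assms by (intro Bochner_Integration.integral_sum) (auto intro: square_int_mult)
  finally show ?thesis by (simp add: cov_def)
qed

lemma cov_cong_AE_right:
  assumes "X \<in> borel_measurable M" "Y \<in> borel_measurable M" "Z \<in> borel_measurable M"
    and "AE \<omega> in M. Y \<omega> = Z \<omega>"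
  shows "cov M X Y = cov M X Z"
  unfolding cov_def using assms by (intro integral_cong_AE) auto

text \<open>The second moment of \<open>r * X + Y\<close> is a quadratic polynomial in
  \<open>r\<close> that is nowhere negative.\<close>

lemma cov_Cauchy_Schwarz:
  assumes "square_int M X" "square_int M Y"
  shows "(cov M X Y)\<^sup>2 \<le> cov M X X * cov M Y Y"
proof -
  have quad: "0 \<le> cov M X X * r\<^sup>2 + 2 * cov M X Y * r + cov M Y Y" for r
  proof -
    have "0 \<le> (LINT \<omega>|M. (r * X \<omega> + Y \<omega>)\<^sup>2)"
      by simp
    also have "\<dots> = (LINT \<omega>|M. r\<^sup>2 * (X \<omega> * X \<omega>) + 2 * r * (X \<omega> * Y \<omega>) + Y \<omega> * Y \<omega>)"
      by (simp add: power2_eq_square algebra_simps)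
    also have "\<dots> = r\<^sup>2 * cov M X X + 2 * r * cov M X Y + cov M Y Y"
      using assms by (simp add: cov_def square_int_mult)
    finally show ?thesis by (simp add: mult_ac)
  qed
  show ?thesis
  proof (cases "cov M X X = 0")
    case True
    have "cov M X Y = 0"
    proof (rule ccontr)
      assume "cov M X Y \<noteq> 0"
      then show False
        \<comment> \<open>Without its quadratic term the polynomial is affine in \<open>r\<close>;
          at this \<open>r\<close> it would equal -1.\<close>
        using quad[of "- (cov M Y Y + 1) / (2 * cov M X Y)"] True by simp
    qed
    then show ?thesis using True by simp
  next
    case False
    then have pos: "0 < cov M X X" using cov_self_nonneg[of M X] by simp
    \<comment> \<open>The polynomial is evaluated at its minimizer and multiplied by the leading
      coefficient to clear the denominator.\<close>
    have "0 \<le> cov M X X * (cov M X X * (- cov M X Y / cov M X X)\<^sup>2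
        + 2 * cov M X Y * (- cov M X Y / cov M X X) + cov M Y Y)"
      using quad[of "- cov M X Y / cov M X X"] pos by (intro mult_nonneg_nonneg) (rule less_imp_le)
    also have "\<dots> = cov M X X * cov M Y Y - (cov M X Y)\<^sup>2"
      using pos by (simp add: field_simps power2_eq_square)
    finally show ?thesis by simp
  qed
qed

section \<open>Orthogonality to closed spans, and lower bounds for errors\<close>

lemma closed_linear_span_square_int: "Z \<in> closed_linear_span M H \<Longrightarrow> square_int M Z"
  by (simp add: closed_linear_span_def square_int_def)

text \<open>Covariance with \<open>V\<close> vanishes on finite combinations of \<open>H\<close> and
  is continuous in mean square by Cauchy-Schwarz, so it vanishes on their limits.\<close>

lemma cov_closed_linear_span_zero:
  assumes V: "square_int M V" and H: "\<And>f. f \<in> H \<Longrightarrow> square_int M f \<and> cov M V f = 0"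
    and Z: "Z \<in> closed_linear_span M H"
  shows "cov M V Z = 0"
proof -
  have "(cov M V Z)\<^sup>2 \<le> 0 + e" if e: "e > 0" for e
  proof -
    \<comment> \<open>This accuracy makes the final Cauchy-Schwarz bound exactly \<open>e\<close>;
      the summand 1 keeps the denominator positive when \<open>V\<close> has variance 0.\<close>
    define \<delta> where "\<delta> = e / (cov M V V + 1)"
    have pos: "0 < cov M V V + 1" using cov_self_nonneg[of M V] by simp
    then have "\<delta> > 0" using e by (simp add: \<delta>_def)
    then obtain F c where F: "F \<subseteq> H"
      and lt: "(LINT \<omega>|M. (Z \<omega> - (\<Sum>f\<in>F. c f * f \<omega>))\<^sup>2) < \<delta>"
      using Z unfolding closed_linear_span_def by blast
    let ?L = "\<lambda>\<omega>. \<Sum>f\<in>F. c f * f \<omega>"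
    have L: "square_int M ?L" using F H by (intro square_int_lincomb) auto
    have "cov M V ?L = (\<Sum>f\<in>F. c f * cov M V f)"
      using F H V by (intro cov_lincomb_right) auto
    also have "\<dots> = 0" using F H by (intro sum.neutral) auto
    finally have "cov M V Z = cov M V (\<lambda>\<omega>. Z \<omega> - ?L \<omega>)"
      using cov_diff_right[OF V closed_linear_span_square_int[OF Z] L] by simp
    then have "(cov M V Z)\<^sup>2 \<le> cov M V V * cov M (\<lambda>\<omega>. Z \<omega> - ?L \<omega>) (\<lambda>\<omega>. Z \<omega> - ?L \<omega>)"
      using cov_Cauchy_Schwarz[OF V square_int_diff[OF closed_linear_span_square_int[OF Z] L]] by simp
    also have "\<dots> \<le> (cov M V V + 1) * \<delta>"
      using lt cov_self_nonneg by (intro mult_mono) (auto simp: cov_self)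
    also have "\<dots> = 0 + e" using pos by (simp add: \<delta>_def)
    finally show ?thesis .
  qed
  then have "(cov M V Z)\<^sup>2 \<le> 0" by (rule field_le_epsilon)
  then show ?thesis by simp
qed

text \<open>The total squared error dominates that of component \<open>k\<close>, which
  Cauchy-Schwarz bounds below in terms of \<alpha>, uniformly in \<open>N\<close>. The number
  \<open>K N\<close> of components varies so that both the state error (constant \<open>n\<close>)
  and the output errors (\<open>N\<close>) are covered.\<close>

lemma cov_zero_if_errors_vanish:
  fixes E :: "nat \<Rightarrow> nat \<Rightarrow> 'a \<Rightarrow> real"
  assumes V: "square_int M V" and E: "\<And>N j. j < K N \<Longrightarrow> square_int M (E N j)"
    and cov: "\<And>N. k < K N \<Longrightarrow> cov M V (E N k) = \<alpha>"
    and ev: "eventually (\<lambda>N. k < K N) sequentially"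
    and lim: "(\<lambda>N. LINT \<omega>|M. (\<Sum>j<K N. (E N j \<omega>)\<^sup>2)) \<longlonglongrightarrow> 0"
  shows "\<alpha> = 0"
proof -
  have bound: "\<alpha>\<^sup>2 \<le> cov M V V * (LINT \<omega>|M. (\<Sum>j<K N. (E N j \<omega>)\<^sup>2))" if k: "k < K N" for N
  proof -
    have "\<alpha>\<^sup>2 \<le> cov M V V * cov M (E N k) (E N k)"
      using cov_Cauchy_Schwarz[OF V E[OF k]] cov[OF k] by simp
    also have "\<dots> \<le> cov M V V * (LINT \<omega>|M. (\<Sum>j<K N. (E N j \<omega>)\<^sup>2))"
    proof (intro mult_left_mono cov_self_nonneg)
      show "cov M (E N k) (E N k) \<le> (LINT \<omega>|M. (\<Sum>j<K N. (E N j \<omega>)\<^sup>2))"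
        unfolding cov_self using E k
        by (intro integral_mono Bochner_Integration.integrable_sum member_le_sum)
          (auto simp: square_int_def)
    qed
    finally show ?thesis .
  qed
  have "\<alpha>\<^sup>2 \<le> cov M V V * 0"
    by (rule tendsto_lowerbound[OF tendsto_mult_left[OF lim]])
      (use ev bound in \<open>auto elim: eventually_mono\<close>)
  then show ?thesis by simp
qed

section \<open>Matrices\<close>

lemma scalar_prod_vec:
  "dim_vec u = n \<Longrightarrow> scalar_prod (u :: real vec) (vec n f) = (\<Sum>j<n. vec_index u j * f j)"
  by (simp add: scalar_prod_def lessThan_atLeast0)

lemma vec_sq_norm_vec: "vec_sq_norm (vec m f) = (\<Sum>j<m. (f j)\<^sup>2)"
  by (simp add: vec_sq_norm_def scalar_prod_vec power2_eq_square)

lemma trunc_mat_mult_vec: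
  "trunc_mat N n C *\<^sub>v vec n f = vec N (\<lambda>k. \<Sum>j<n. C k j * f j)"
  by (rule eq_vecI) (simp_all add: trunc_mat_def scalar_prod_vec)

text \<open>Iterating gives \<open>h 0\<close> as the \<open>m\<close>-th power of \<open>A\<close>
  applied to \<open>h m\<close>. The powers of a stable matrix decay geometrically while
  \<open>h m\<close> stays bounded, so \<open>h 0\<close> is arbitrarily small.\<close>

lemma stable_bounded_backward_orbit_zero:
  fixes A :: "real mat" and h :: "nat \<Rightarrow> real vec"
  assumes A: "A \<in> carrier_mat n n" and n: "n > 0" and stable: "asymptotically_stable A"
    and h: "\<And>m. h m \<in> carrier_vec n" and orbit: "\<And>m. h m = A *\<^sub>v h (Suc m)"
    and bound: "\<And>m j. j < n \<Longrightarrow> \<bar>vec_index (h m) j\<bar> \<le> K"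
  shows "h 0 = 0\<^sub>v n"
proof -
  let ?c = "map_mat complex_of_real"
  have Ac: "?c A \<in> carrier_mat n n" using A by simp
  obtain \<mu> where \<mu>: "\<mu> \<in> spectrum (?c A)" "spectral_radius (?c A) = cmod \<mu>"
    using spectral_radius_mem_max(1)[OF Ac n] by auto
  \<comment> \<open>Midpoint between the spectral radius of \<open>A\<close> and 1. Dividing
    \<open>A\<close> by \<open>d\<close> leaves a spectral radius below 1, so the powers of
    \<open>B\<close> are bounded and those of \<open>A\<close> decay like
    \<open>d ^ m\<close>.\<close>
  define d where "d = (1 + cmod \<mu>) / 2"
  have "cmod \<mu> < 1" using stable \<mu> by (auto simp: asymptotically_stable_def spectrum_def)
  then have d: "cmod \<mu> < d" "d < 1" "0 < d"
    using norm_ge_zero[of \<mu>] by (simp_all add: d_def add_pos_nonneg)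
  define B where "B = (1 / d) \<cdot>\<^sub>m A"
  have B: "B \<in> carrier_mat n n" and Bc: "?c B \<in> carrier_mat n n" using A by (auto simp: B_def)
  have cA: "?c A = complex_of_real d \<cdot>\<^sub>m ?c B"
    using A d by (intro eq_matI) (auto simp: B_def)
  have "spectral_radius (?c B) < 1"
  proof -
    obtain \<nu> where \<nu>: "\<nu> \<in> spectrum (?c B)" "spectral_radius (?c B) = cmod \<nu>"
      using spectral_radius_mem_max(1)[OF Bc n] by auto
    then obtain u where u: "u \<in> carrier_vec n" "u \<noteq> 0\<^sub>v n" "?c B *\<^sub>v u = \<nu> \<cdot>\<^sub>v u"
      using B by (auto simp: spectrum_def eigenvalue_def eigenvector_def)
    have "?c A *\<^sub>v u = complex_of_real d \<cdot>\<^sub>v (?c B *\<^sub>v u)"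
      unfolding cA using Bc u(1) by (intro eq_vecI) auto
    also have "\<dots> = (complex_of_real d * \<nu>) \<cdot>\<^sub>v u"
      unfolding u(3) by (simp add: smult_smult_assoc)
    \<comment> \<open>Scaling an eigenvalue \<nu> of \<open>B\<close> by \<open>d\<close> gives one
      of \<open>A\<close>, whose modulus is at most that of \<mu> and hence below
      \<open>d\<close>.\<close>
    finally have "complex_of_real d * \<nu> \<in> spectrum (?c A)"
      using u A by (auto simp: spectrum_def eigenvalue_def eigenvector_def)
    then have "cmod (complex_of_real d * \<nu>) \<le> cmod \<mu>"
      using spectral_radius_mem_max(2)[OF Ac n] \<mu>(2) by (metis image_eqI)
    then have "d * cmod \<nu> < d * 1" using d by (simp only: norm_mult norm_of_real)
    then show ?thesis unfolding \<nu>(2) using d(3) by (rule mult_left_less_imp_less[OF _ less_imp_le])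
  qed
  then obtain b where b: "\<And>m. norm_bound (?c B ^\<^sub>m m) b"
    using spectral_radius_jnf_norm_bound_less_1_upper_triangular[OF Bc] by auto
  have entry: "\<bar>(B ^\<^sub>m m) $$ (i, j)\<bar> \<le> b" if "i < n" "j < n" for m i j
  proof -
    have "?c B ^\<^sub>m m = ?c (B ^\<^sub>m m)" by (rule of_real_hom.mat_hom_pow[OF B, symmetric])
    then show ?thesis using b[of m] that B by (auto simp: norm_bound_def)
  qed
  \<comment> \<open>The decay factor is moved from the matrix into the orbit, which makes
    \<open>g\<close> a backward orbit of \<open>B\<close>.\<close>
  define g where "g m = d ^ m \<cdot>\<^sub>v h m" for m
  have g: "g m \<in> carrier_vec n" for m using h by (simp add: g_def)
  have step: "g m = B *\<^sub>v g (Suc m)" for m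
  proof -
    have "g m = d ^ m \<cdot>\<^sub>v (A *\<^sub>v h (Suc m))" using orbit[of m] by (simp add: g_def)
    also have "\<dots> = B *\<^sub>v g (Suc m)"
      using A h[of "Suc m"] d by (intro eq_vecI) (auto simp: B_def g_def)
    finally show ?thesis .
  qed
  have iter: "h 0 = B ^\<^sub>m m *\<^sub>v g m" for m
  proof (induction m)
    case 0
    then show ?case using B h[of 0] by (simp add: g_def)
  next
    case (Suc m)
    have "B ^\<^sub>m Suc m *\<^sub>v g (Suc m) = B ^\<^sub>m m *\<^sub>v (B *\<^sub>v g (Suc m))"
      using B g by (simp add: assoc_mult_mat_vec[OF pow_carrier_mat[OF B] B])
    then show ?case using Suc step[of m] by simp
  qed
  show ?thesis
  proof (rule eq_vecI)
    fix i assume "i < dim_vec (0\<^sub>v n :: real vec)"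
    then have i: "i < n" by simp
    have K: "0 \<le> K" using bound[OF i, of 0] by linarith
    \<comment> \<open>There are \<open>n\<close> summands; \<open>b\<close> bounds the entries of
      the powers of \<open>B\<close>, and \<open>K\<close> those of \<open>h m\<close>.\<close>
    have le: "\<bar>vec_index (h 0) i\<bar> \<le> real n * b * K * d ^ m" for m
    proof -
      have "vec_index (h 0) i = (\<Sum>j<n. (B ^\<^sub>m m) $$ (i, j) * (d ^ m * vec_index (h m) j))"
        using arg_cong[OF iter[of m], of "\<lambda>u. vec_index u i"] i
          carrier_vecD[OF h[of m]] carrier_matD[OF pow_carrier_mat[OF B, of m]] carrier_matD[OF B]
        by (simp add: g_def scalar_prod_def lessThan_atLeast0)
      also have "\<bar>\<dots>\<bar> \<le> (\<Sum>j<n. \<bar>(B ^\<^sub>m m) $$ (i, j) * (d ^ m * vec_index (h m) j)\<bar>)"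
        by (rule sum_abs)
      also have "\<dots> \<le> (\<Sum>j<n. b * (d ^ m * K))"
      proof (rule sum_mono)
        fix j assume "j \<in> {..<n}"
        then have j: "j < n" by simp
        have "0 \<le> b" using entry[OF i i, of 0] by linarith
        then show "\<bar>(B ^\<^sub>m m) $$ (i, j) * (d ^ m * vec_index (h m) j)\<bar> \<le> b * (d ^ m * K)"
          using entry[OF i j] bound[OF j] d K
          by (simp add: abs_mult) (intro mult_mono, auto)
      qed
      finally show ?thesis by (simp add: mult_ac)
    qed
    have "(\<lambda>m. real n * b * K * d ^ m) \<longlonglongrightarrow> real n * b * K * 0"
      using d by (intro tendsto_intros LIMSEQ_power_zero) auto
    then have "\<bar>vec_index (h 0) i\<bar> \<le> real n * b * K * 0"
      by (rule tendsto_lowerbound) (use le in auto)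
    then show "vec_index (h 0) i = vec_index (0\<^sub>v n) i" using i by simp
  qed (use h[of 0] in simp)
qed

text \<open>A nonzero vector killed by every truncation would make 0 an eigenvalue of every Gram
  matrix, so the least eigenvalues could not diverge to infinity.\<close>

lemma strongly_linearly_independent_kernel:
  assumes C: "strongly_linearly_independent n C" and q: "q \<in> carrier_vec n" "q \<noteq> 0\<^sub>v n"
  shows "\<exists>N. trunc_mat N n C *\<^sub>v q \<noteq> 0\<^sub>v N"
proof (rule ccontr)
  assume "\<nexists>N. trunc_mat N n C *\<^sub>v q \<noteq> 0\<^sub>v N"
  then have zero: "trunc_mat N n C *\<^sub>v q = 0\<^sub>v N" for N by blast
  let ?G = "\<lambda>N. transpose_mat (trunc_mat N n C) * trunc_mat N n C"
  have le: "lambda_min (?G N) \<le> 0" for N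
  proof -
    have T: "trunc_mat N n C \<in> carrier_mat N n" by (simp add: trunc_mat_def)
    then have G: "?G N \<in> carrier_mat n n" by simp
    have "?G N *\<^sub>v q = transpose_mat (trunc_mat N n C) *\<^sub>v (trunc_mat N n C *\<^sub>v q)"
      using T q(1) by (intro assoc_mult_mat_vec) auto
    also have "\<dots> = 0 \<cdot>\<^sub>v q"
      unfolding zero using T q(1) by (intro eq_vecI) auto
    finally have "0 \<in> spectrum (?G N)"
      using q T by (auto simp: spectrum_def eigenvalue_def eigenvector_def)
    then show ?thesis
      unfolding lambda_min_def using card_finite_spectrum(1)[OF G] by (rule Min_le[rotated])
  qed
  have "eventually (\<lambda>N. 1 \<le> lambda_min (?G N)) sequentially"
    using C unfolding strongly_linearly_independent_def filterlim_at_top by blast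
  then obtain N where "1 \<le> lambda_min (?G N)"
    by (auto simp: eventually_sequentially)
  then show False using le[of N] by simp
qed

text \<open>With zero input matrix the state never leaves the origin, so a unit vector is out of
  reach.\<close>

lemma reachable_input_nonzero:
  assumes "reachable A B" "A \<in> carrier_mat n n" "B \<in> carrier_mat n m" "n > 0"
  shows "B \<noteq> 0\<^sub>m n m"
proof
  assume B: "B = 0\<^sub>m n m"
  have zero: "driven_state A B u T = 0\<^sub>v n" if "\<And>k. u k \<in> carrier_vec m" for u T
  proof (induction T)
    case 0
    then show ?case using assms by simp
  next
    case (Suc T)
    then show ?case using assms(2) that[of T] by (intro eq_vecI) (auto simp: B)
  qed
  have "unit_vec n 0 \<in> carrier_vec (dim_row A)" using assms by simp
  then obtain T u where "\<And>k. u k \<in> carrier_vec m" "driven_state A B u T = unit_vec n 0"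
    using assms(1,3) unfolding reachable_def by fastforce
  then have "unit_vec n 0 = (0\<^sub>v n :: real vec)" using zero by metis
  then have "vec_index (unit_vec n 0 :: real vec) 0 = vec_index (0\<^sub>v n) 0" by simp
  then show False using assms(4) by simp
qed

text \<open>As a covariance matrix, \<open>Q\<close> satisfies the Cauchy-Schwarz inequality
  entrywise: a nonzero entry forces nonzero diagonal entries in its row and column.\<close>

lemma white_noise_variance_pos:
  assumes v: "white_noise M {..<n} v (\<lambda>i j. Q $$ (i, j))" and Q: "Q \<in> carrier_mat n n" "Q \<noteq> 0\<^sub>m n n"
  shows "\<exists>i<n. 0 < Q $$ (i, i)"
proof -
  have vi: "square_int M (v 0 i)" if "i < n" for i
    using v that by (auto simp: white_noise_def intro: zero_mean_L2_square_int)
  have cov: "cov M (v 0 i) (v 0 j) = Q $$ (i, j)" if "i < n" "j < n" for i j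
    using v that by (auto simp: white_noise_def)
  have "\<exists>i<n. \<exists>j<n. Q $$ (i, j) \<noteq> 0"
  proof (rule ccontr)
    assume "\<not> ?thesis"
    then have "Q = 0\<^sub>m n n" using Q(1) by (intro eq_matI) auto
    then show False using Q(2) by simp
  qed
  then obtain i j where ij: "i < n" "j < n" "Q $$ (i, j) \<noteq> 0" by blast
  have "(Q $$ (i, j))\<^sup>2 \<le> Q $$ (i, i) * Q $$ (j, j)"
    using cov_Cauchy_Schwarz[OF vi vi, of i j] ij cov by simp
  then have "Q $$ (i, i) \<noteq> 0" using ij by auto
  moreover have "0 \<le> Q $$ (i, i)" using cov_self_nonneg[of M "v 0 i"] cov ij by simp
  ultimately show ?thesis using ij by force
qed

section \<open>The prediction error\<close>

theorem corollary1:
  fixes M :: "'a measure"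
    and n :: nat
    and A Q :: "real mat"
    and C :: "nat \<Rightarrow> nat \<Rightarrow> real"
    and R :: "nat \<Rightarrow> nat \<Rightarrow> real"
    and x v y w :: "int \<Rightarrow> nat \<Rightarrow> 'a \<Rightarrow> real"
    and xhat :: "nat \<Rightarrow> int \<Rightarrow> nat \<Rightarrow> 'a \<Rightarrow> real"
    and t :: int
  assumes prob: "prob_space M"
    and dims: "n \<ge> 1" "A \<in> carrier_mat n n" "Q \<in> carrier_mat n n"
    and state_eq: "\<And>s. AE \<omega> in M.
        trunc_vec n (x (s + 1)) \<omega> = A *\<^sub>v trunc_vec n (x s) \<omega> + trunc_vec n (v s) \<omega>"
    and output_eq: "\<And>N s. AE \<omega> in M.
        trunc_vec N (y s) \<omega> = trunc_mat N n C *\<^sub>v trunc_vec n (x s) \<omega> + trunc_vec N (w s) \<omega>"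
    and stable: "asymptotically_stable A"
    and v_white: "white_noise M {..<n} v (\<lambda>i j. Q $$ (i, j))"
    and x_stationary: "wide_sense_stationary M {..<n} x"
    and w_white: "white_noise M UNIV w R"
    and v_w_uncorrelated: "\<And>s r i k. i < n \<Longrightarrow> cov M (v s i) (w r k) = 0"
    and C_strong: "strongly_linearly_independent n C"
    and w_idiosyncratic: "idiosyncratic M (w 0)"
    and model_stationary: "wide_sense_stationary M ({..<n} <+> UNIV)
        (\<lambda>s. case_sum (x s) (y s))"
    and minimal: "reachable A Q" "observable A C"
    and R_pos: "\<And>N. positive_definite (trunc_mat N N R)"
    and predictor: "\<And>N s. kalman_predictor M n x y N s (xhat N s)"
  shows "\<not> (\<lambda>N. LINT \<omega>|M. vec_sq_norm
            (trunc_vec n (x t) \<omega> - trunc_vec n (xhat N t) \<omega>)) \<longlonglongrightarrow> 0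
    \<and> \<not> (\<lambda>N. LINT \<omega>|M. vec_sq_norm
            (trunc_mat N n C *\<^sub>v trunc_vec n (x t) \<omega>
              - trunc_mat N n C *\<^sub>v trunc_vec n (xhat N t) \<omega>)) \<longlonglongrightarrow> 0
    \<and> \<not> (\<lambda>N. LINT \<omega>|M. vec_sq_norm
            (trunc_vec N (y t) \<omega>
              - trunc_mat N n C *\<^sub>v trunc_vec n (xhat N t) \<omega>)) \<longlonglongrightarrow> 0"
proof -

  \<comment> \<open>Square integrability and the model equations by component\<close>
  have xL: "square_int M (x s j)" if "j < n" for s j
    using x_stationary that by (auto simp: wide_sense_stationary_def intro: zero_mean_L2_square_int)
  have vL: "square_int M (v s j)" if "j < n" for s j
    using v_white that by (auto simp: white_noise_def intro: zero_mean_L2_square_int)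
  have wL: "square_int M (w s k)" for s k
    using w_white by (auto simp: white_noise_def intro: zero_mean_L2_square_int)
  have yL: "square_int M (y s k)" for s k
  proof -
    have "zero_mean_L2 M (case_sum (x s) (y s) (Inr k))"
      using model_stationary unfolding wide_sense_stationary_def by blast
    then show ?thesis by (simp add: zero_mean_L2_square_int)
  qed
  have x_eq: "AE \<omega> in M. x (s + 1) j \<omega> = (\<Sum>l<n. A $$ (j, l) * x s l \<omega>) + v s j \<omega>"
    if j: "j < n" for s j
    using state_eq[of s]
  proof (rule eventually_mono)
    fix \<omega>
    assume "trunc_vec n (x (s + 1)) \<omega> = A *\<^sub>v trunc_vec n (x s) \<omega> + trunc_vec n (v s) \<omega>"
    from arg_cong[OF this, of "\<lambda>u. vec_index u j"]
    show "x (s + 1) j \<omega> = (\<Sum>l<n. A $$ (j, l) * x s l \<omega>) + v s j \<omega>"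
      using j dims by (simp add: trunc_vec_def scalar_prod_vec)
  qed
  have y_eq: "AE \<omega> in M. y s k \<omega> = (\<Sum>l<n. C k l * x s l \<omega>) + w s k \<omega>" for s k
    \<comment> \<open>Components count from 0, so \<open>Suc k\<close> is the shortest truncation
      that contains component \<open>k\<close>.\<close>
    using output_eq[of "Suc k" s]
  proof (rule eventually_mono)
    fix \<omega>
    assume "trunc_vec (Suc k) (y s) \<omega>
      = trunc_mat (Suc k) n C *\<^sub>v trunc_vec n (x s) \<omega> + trunc_vec (Suc k) (w s) \<omega>"
    from arg_cong[OF this, of "\<lambda>u. vec_index u k"]
    show "y s k \<omega> = (\<Sum>l<n. C k l * x s l \<omega>) + w s k \<omega>"
      by (simp add: trunc_vec_def trunc_mat_mult_vec)
  qed

  \<comment> \<open>The model equations for covariances with a fixed variable\<close>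
  have cov_x: "cov M V (x (s + 1) j)
      = (\<Sum>l<n. A $$ (j, l) * cov M V (x s l)) + cov M V (v s j)"
    if V: "square_int M V" and j: "j < n" for V s j
  proof -
    have S: "square_int M (\<lambda>\<omega>. \<Sum>l<n. A $$ (j, l) * x s l \<omega>)"
      using xL by (intro square_int_lincomb) auto
    have "cov M V (x (s + 1) j)
        = cov M V (\<lambda>\<omega>. (\<Sum>l<n. A $$ (j, l) * x s l \<omega>) + v s j \<omega>)"
      using V xL[OF j] square_int_add[OF S vL[OF j]] x_eq[OF j]
      by (intro cov_cong_AE_right) (auto simp: square_int_def)
    also have "\<dots> = (\<Sum>l<n. A $$ (j, l) * cov M V (x s l)) + cov M V (v s j)"
      using cov_add_right[OF V S vL[OF j]]
        cov_lincomb_right[OF V, of "{..<n}" "x s" "\<lambda>l. A $$ (j, l)"] xL by simp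
    finally show ?thesis .
  qed
  have cov_y: "cov M V (y s k) = (\<Sum>l<n. C k l * cov M V (x s l)) + cov M V (w s k)"
    if V: "square_int M V" for V s k
  proof -
    have S: "square_int M (\<lambda>\<omega>. \<Sum>l<n. C k l * x s l \<omega>)"
      using xL by (intro square_int_lincomb) auto
    have "cov M V (y s k) = cov M V (\<lambda>\<omega>. (\<Sum>l<n. C k l * x s l \<omega>) + w s k \<omega>)"
      using V yL square_int_add[OF S wL] y_eq
      by (intro cov_cong_AE_right) (auto simp: square_int_def)
    also have "\<dots> = (\<Sum>l<n. C k l * cov M V (x s l)) + cov M V (w s k)"
      using cov_add_right[OF V S wL]
        cov_lincomb_right[OF V, of "{..<n}" "x s" "C k"] xL by simp
    finally show ?thesis .
  qed

  \<comment> \<open>An innovation orthogonal to past states and outputs\<close>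
  have "Q \<noteq> 0\<^sub>m n n"
    using reachable_input_nonzero[OF minimal(1) dims(2,3)] dims(1) by simp
  then obtain i where i: "i < n" "0 < Q $$ (i, i)"
    using white_noise_variance_pos[OF v_white dims(3)] by blast
  define V where "V = v (t - 1) i"
  have V: "square_int M V" unfolding V_def using vL i by simp
  have cov_v: "cov M V (v s j) = (if s = t - 1 then Q $$ (i, j) else 0)" if "j < n" for s j
    using v_white i that by (auto simp: V_def white_noise_def)
  have cov_w: "cov M V (w s k) = 0" for s k
    using v_w_uncorrelated i by (simp add: V_def)
  \<comment> \<open>The state equation makes these covariances, taken backwards in time, a bounded orbit of \<open>A\<close>.\<close>
  have cov_past_x: "cov M V (x s j) = 0" if j: "j < n" and s: "s \<le> t - 1" for s j
  proof -
    define h where "h m = vec n (\<lambda>l. cov M V (x (s - int m) l))" for m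
    \<comment> \<open>Stationarity reduces all variances to time 0, and the sum over
      \<open>l\<close> makes the bound common to all components. The summand 1 comes from bounding
      \<open>\<bar>a\<bar>\<close> by \<open>a\<^sup>2 + 1\<close>, which avoids square
      roots.\<close>
    define K where "K = 1 + (\<Sum>l<n. cov M V V * cov M (x 0 l) (x 0 l))"
    have "h 0 = 0\<^sub>v n"
    proof (rule stable_bounded_backward_orbit_zero[OF dims(2) _ stable])
      show "0 < n" using dims by simp
      show "h m \<in> carrier_vec n" for m by (simp add: h_def)
      show "h m = A *\<^sub>v h (Suc m)" for m
      proof (rule eq_vecI)
        fix l assume "l < dim_vec (A *\<^sub>v h (Suc m))"
        then have l: "l < n" using dims by simp
        \<comment> \<open>The noise entering in this transition has time at most
          \<open>t - 2\<close>, so whiteness makes it uncorrelated with \<open>V\<close>.\<close>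
        have "s - int m = (s - int (Suc m)) + 1" by simp
        then have "cov M V (x (s - int m) l)
            = (\<Sum>r<n. A $$ (l, r) * cov M V (x (s - int (Suc m)) r))"
          using cov_x[OF V l, of "s - int (Suc m)"] cov_v[OF l] s by simp
        then show "vec_index (h m) l = vec_index (A *\<^sub>v h (Suc m)) l"
          using l dims by (simp add: h_def scalar_prod_vec)
      qed (use dims in \<open>simp add: h_def\<close>)
      show "\<bar>vec_index (h m) l\<bar> \<le> K" if l: "l < n" for m l
      proof -
        have "cov M (x (0 + (s - int m)) l) (x (0 + (s - int m)) l) = cov M (x 0 l) (x 0 l)"
          using x_stationary l unfolding wide_sense_stationary_def by blast
        then have "(vec_index (h m) l)\<^sup>2 \<le> cov M V V * cov M (x 0 l) (x 0 l)"
          using cov_Cauchy_Schwarz[OF V xL[OF l, of "s - int m"]] l by (simp add: h_def)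
        also have "\<dots> \<le> (\<Sum>l<n. cov M V V * cov M (x 0 l) (x 0 l))"
          using l by (intro member_le_sum) (auto intro!: mult_nonneg_nonneg cov_self_nonneg)
        finally have "(vec_index (h m) l)\<^sup>2 + 1 \<le> K" by (simp add: K_def)
        moreover have "\<bar>a\<bar> \<le> a\<^sup>2 + 1" for a :: real
        proof -
          have "2 * \<bar>a\<bar> \<le> a\<^sup>2 + 1" using sum_squares_bound[of "\<bar>a\<bar>" 1] by simp
          then show ?thesis using abs_ge_zero[of a] by linarith
        qed
        ultimately show ?thesis by (meson order_trans)
      qed
    qed
    then have "vec_index (h 0) j = 0" using j by simp
    then show ?thesis using j by (simp add: h_def)
  qed
  \<comment> \<open>Even the latest observed output, at time \<open>t - 1\<close>, depends only on
    \<open>x (t - 1)\<close> and \<open>w (t - 1)\<close>, both uncorrelated with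
    \<open>V\<close>.\<close>
  have cov_past_y: "cov M V (y s k) = 0" if "s \<le> t - 1" for s k
    using cov_y[OF V] cov_past_x that cov_w by simp
  have span: "xhat N t j \<in> closed_linear_span M (past y N (t - 1))" if "j < n" for N j
    using predictor[of N t] that by (auto simp: kalman_predictor_def best_linear_estimate_def)
  have hL: "square_int M (xhat N t j)" if "j < n" for N j
    using span[OF that] by (rule closed_linear_span_square_int)
  have cov_xhat: "cov M V (xhat N t j) = 0" if "j < n" for N j
    using V _ span[OF that]
    by (rule cov_closed_linear_span_zero) (auto simp: past_def yL cov_past_y)
  \<comment> \<open>In the transition from \<open>t - 1\<close> to \<open>t\<close> only the noise
    term \<open>v (t - 1) j\<close> correlates with \<open>V\<close>.\<close>
  have cov_xt: "cov M V (x t j) = Q $$ (i, j)" if "j < n" for j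
    using cov_x[OF V that, of "t - 1"] cov_past_x cov_v[OF that] by simp

  \<comment> \<open>Covariances of the innovation with the prediction errors\<close>
  define q where "q = vec n (\<lambda>j. Q $$ (i, j))"
  have q: "q \<in> carrier_vec n" "q \<noteq> 0\<^sub>v n"
  proof -
    have "vec_index q i \<noteq> vec_index (0\<^sub>v n) i" using i by (simp add: q_def)
    then show "q \<noteq> 0\<^sub>v n" by auto
  qed (simp add: q_def)
  \<comment> \<open>These sums are the components of \<open>C\<close> applied to \<open>q\<close>;
    if all vanished, \<open>q\<close> would lie in the kernel of every truncation.\<close>
  have no_kernel: False if "\<And>k. (\<Sum>j<n. C k j * Q $$ (i, j)) = 0"
  proof -
    have "trunc_mat N n C *\<^sub>v q = 0\<^sub>v N" for N
      using that by (simp add: q_def trunc_mat_mult_vec zero_vec_def)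
    then show False using strongly_linearly_independent_kernel[OF C_strong q] by blast
  qed
  have cx: "square_int M (\<lambda>\<omega>. \<Sum>j<n. C k j * x t j \<omega>)" for k
    using xL by (intro square_int_lincomb) auto
  have ch: "square_int M (\<lambda>\<omega>. \<Sum>j<n. C k j * xhat N t j \<omega>)" for k N
    using hL by (intro square_int_lincomb) auto
  have cov_cx: "cov M V (\<lambda>\<omega>. \<Sum>j<n. C k j * x t j \<omega>) = (\<Sum>j<n. C k j * Q $$ (i, j))" for k
    using cov_lincomb_right[OF V, of "{..<n}" "x t" "C k"] xL cov_xt by simp
  have cov_ch: "cov M V (\<lambda>\<omega>. \<Sum>j<n. C k j * xhat N t j \<omega>) = 0" for k N
    using cov_lincomb_right[OF V, of "{..<n}" "xhat N t" "C k"] hL cov_xhat by simp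
  have vec_diff: "vec m f - vec m g = vec m (\<lambda>j. f j - g j)" for m and f g :: "nat \<Rightarrow> real"
    by (intro eq_vecI) auto

  \<comment> \<open>The three limits\<close>
  show ?thesis
  proof (intro conjI notI)
    assume lim: "(\<lambda>N. LINT \<omega>|M. vec_sq_norm
        (trunc_vec n (x t) \<omega> - trunc_vec n (xhat N t) \<omega>)) \<longlonglongrightarrow> 0"
    \<comment> \<open>Component \<open>i\<close> of the state error has the constant covariance
      \<open>Q $$ (i, i)\<close> with \<open>V\<close>, for every \<open>N\<close>.\<close>
    have "Q $$ (i, i) = 0"
    proof (rule cov_zero_if_errors_vanish[OF V])
      show "(\<lambda>N. LINT \<omega>|M. (\<Sum>j<n. (x t j \<omega> - xhat N t j \<omega>)\<^sup>2)) \<longlonglongrightarrow> 0"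
        using lim by (simp add: trunc_vec_def vec_diff vec_sq_norm_vec)
      show "cov M V (\<lambda>\<omega>. x t i \<omega> - xhat N t i \<omega>) = Q $$ (i, i)" for N
        using i by (simp add: cov_diff_right V xL hL cov_xt cov_xhat)
    qed (use i in \<open>auto intro: square_int_diff xL hL\<close>)
    then show False using i by simp
  next
    assume lim: "(\<lambda>N. LINT \<omega>|M. vec_sq_norm
        (trunc_mat N n C *\<^sub>v trunc_vec n (x t) \<omega>
          - trunc_mat N n C *\<^sub>v trunc_vec n (xhat N t) \<omega>)) \<longlonglongrightarrow> 0"
    \<comment> \<open>For fixed \<open>k\<close>, error component \<open>k\<close> exists once
      \<open>N\<close> exceeds \<open>k\<close>, and its covariance with \<open>V\<close> does not
      depend on \<open>N\<close>.\<close>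
    have "(\<Sum>j<n. C k j * Q $$ (i, j)) = 0" for k
    proof (rule cov_zero_if_errors_vanish[OF V])
      show "(\<lambda>N. LINT \<omega>|M. (\<Sum>k<N.
          ((\<Sum>j<n. C k j * x t j \<omega>) - (\<Sum>j<n. C k j * xhat N t j \<omega>))\<^sup>2)) \<longlonglongrightarrow> 0"
        using lim by (simp add: trunc_vec_def trunc_mat_mult_vec vec_diff vec_sq_norm_vec)
      show "cov M V (\<lambda>\<omega>. (\<Sum>j<n. C k j * x t j \<omega>) - (\<Sum>j<n. C k j * xhat N t j \<omega>))
          = (\<Sum>j<n. C k j * Q $$ (i, j))" for N
        by (simp add: cov_diff_right V cx ch cov_cx cov_ch)
      show "eventually (\<lambda>N. k < N) sequentially" by (rule eventually_gt_at_top)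
    qed (intro square_int_diff cx ch)
    then show False by (rule no_kernel)
  next
    assume lim: "(\<lambda>N. LINT \<omega>|M. vec_sq_norm
        (trunc_vec N (y t) \<omega> - trunc_mat N n C *\<^sub>v trunc_vec n (xhat N t) \<omega>)) \<longlonglongrightarrow> 0"
    \<comment> \<open>The extra noise \<open>w t\<close> is uncorrelated with \<open>V\<close>, so
      the covariance is the same as for the common component.\<close>
    have "(\<Sum>j<n. C k j * Q $$ (i, j)) = 0" for k
    proof (rule cov_zero_if_errors_vanish[OF V])
      show "(\<lambda>N. LINT \<omega>|M. (\<Sum>k<N. (y t k \<omega> - (\<Sum>j<n. C k j * xhat N t j \<omega>))\<^sup>2)) \<longlonglongrightarrow> 0"
        using lim by (simp add: trunc_vec_def trunc_mat_mult_vec vec_diff vec_sq_norm_vec)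
      show "cov M V (\<lambda>\<omega>. y t k \<omega> - (\<Sum>j<n. C k j * xhat N t j \<omega>))
          = (\<Sum>j<n. C k j * Q $$ (i, j))" for N
        by (simp add: cov_diff_right V yL ch cov_ch cov_y cov_w cov_xt)
      show "eventually (\<lambda>N. k < N) sequentially" by (rule eventually_gt_at_top)
    qed (intro square_int_diff yL ch)
    then show False by (rule no_kernel)
  qed
qed

end
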